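(* Let $n\ge1$ and let $(k,\mu)$ be a type of $n$. Then $$p_{k,\mu}=\sum_Z G_Z,$$ where the sum is over all $k$-Young tableaux $Z$ of shape $(k,\mu)$.
   Context: **Types.** A type of $n$, written $(k,\mu)\vdash n$, is a pair with $k\in\{1,\ldots,n\}$ and $\mu=(\mu_1\ge\cdots\ge\mu_{n-1}\ge0)$ a partition of $n-k$ written with exactly $n-1$ terms by appending $0$'s at the end. **The numbers $p_{k,\mu}$.** An inversion sequence of length $n$ is an integer sequence $\mathbf e=(e_1,\ldots,e_n)$ with $0\le e_i<i$ for all $i$. Let $|\mathbf e|_j=\#\{i: e_i=j\}$. The type of $\mathbf e$ is $(|\mathbf e|_0,\mu(\mathbf e))$, where $\mu(\mathbf e)$ is the weakly decreasing rearrangement of $|\mathbf e|_1,\ldots,|\mathbf e|_{n-1}$. For $(k,\mu)\vdash n$, $p_{k,\mu}$ is the number of inversion sequences of length $n$ of type $(k,\mu)$. **$k$-Young tableaux.** For $(k,\mu)\vdash n$, the $(k,\mu)$-diagram consists of left-justified boxes: $k$ boxes in the bottom row (row 1), and above it the Ferrers diagram of $\mu$ (the "top Young diagram") with $\mu_1$ boxes in row 2, $\mu_2$ boxes in row 3, and so on, rows being numbered from bottom to top. (There is no requirement that $k\ge\mu_1$.) A $k$-Young tableau of shape $(k,\mu)$ is a filling of the $n$ boxes by $1,2,\ldots,n$, each used exactly once, such that in the top Young diagram all rows increase from left to right and all columns increase from bottom to top, and the bottom row is an increasing sequence of length $k$ starting with $1$. No condition is imposed between the bottom row and the top part. **$g$-index.**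 To the left of a $k$-Young tableau $Z$ one adds a special column (column 0) of $n$ boxes in rows $1,\ldots,n$, the box in row $r$ containing the label $r$. For $v\in\{1,\ldots,n\}$: if $v$ is in the bottom row, $g_Z(v)=1$; if $v$ is in the top Young diagram, in column $i\ge1$ and row $j\ge2$, then $g_Z(v)$ is the number of boxes in column $i-1$ and in rows $j'\ge j$ whose entry is less than or equal to $v$ (for $i=1$ the boxes counted are those of the special column 0). The $g$-index of $Z$ is $G_Z=g_Z(1)g_Z(2)\cdots g_Z(n)$. *)

theory Defs
  imports Main "HOL-Library.FuncSet"
begin

text \<open>
  Partitions are padded with zeros to exactly \<open>n - 1\<close> terms; since lists are indexed from 0,
  the part \<open>\<mu>\<^sub>i\<close> is \<open>\<mu> ! (i - 1)\<close>.
\<close>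

definition is_type :: "nat \<Rightarrow> nat \<Rightarrow> nat list \<Rightarrow> bool" where
  "is_type n k \<mu> \<longleftrightarrow>
     1 \<le> k \<and> k \<le> n \<and> length \<mu> = n - 1 \<and> sorted_wrt (\<ge>) \<mu> \<and> sum_list \<mu> = n - k"

text \<open>
  The entry \<open>e\<^sub>i\<close> is \<open>e ! (i - 1)\<close>, so \<open>0 \<le> e\<^sub>i < i\<close> for \<open>1 \<le> i \<le> n\<close> becomes
  \<open>e ! i < i + 1\<close> for \<open>i < n\<close>.
\<close>

definition inversion_sequences :: "nat \<Rightarrow> nat list set" where
  "inversion_sequences n = {e. length e = n \<and> (\<forall>i<n. e ! i < i + 1)}"

definition type_of_seq :: "nat list \<Rightarrow> nat \<times> nat list" where
  "type_of_seq e = (count_list e 0, rev (sort (map (count_list e) [1..<length e])))"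

definition p_num :: "nat \<Rightarrow> nat \<Rightarrow> nat list \<Rightarrow> nat" where
  "p_num n k \<mu> = card {e \<in> inversion_sequences n. type_of_seq e = (k, \<mu>)}"

text \<open>
  A box is a pair \<open>(r, c)\<close> of row and column, both numbered from 1; rows are numbered from
  bottom to top. Row \<open>r \<ge> 2\<close> holds the part \<open>\<mu>\<^sub>r\<^sub>-\<^sub>1 = \<mu> ! (r - 2)\<close>.
\<close>

definition bottom_row :: "nat \<Rightarrow> (nat \<times> nat) set" where
  "bottom_row k = {(r, c). r = 1 \<and> 1 \<le> c \<and> c \<le> k}"

definition top_diagram :: "nat list \<Rightarrow> (nat \<times> nat) set" where
  "top_diagram \<mu> = {(r, c). 2 \<le> r \<and> r \<le> length \<mu> + 1 \<and> 1 \<le> c \<and> c \<le> \<mu> ! (r - 2)}"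

definition diagram :: "nat \<Rightarrow> nat list \<Rightarrow> (nat \<times> nat) set" where
  "diagram k \<mu> = bottom_row k \<union> top_diagram \<mu>"

text \<open>
  Fillings are functions on all of \<open>nat \<times> nat\<close>; extensionality (the value \<open>undefined\<close>
  outside the diagram) ensures that each tableau is represented by exactly one function.
\<close>

definition young_tableaux :: "nat \<Rightarrow> nat \<Rightarrow> nat list \<Rightarrow> (nat \<times> nat \<Rightarrow> nat) set" where
  "young_tableaux n k \<mu> =
     {Z \<in> extensional (diagram k \<mu>).
        bij_betw Z (diagram k \<mu>) {1..n} \<and>
        (\<forall>r c c'. (r, c) \<in> top_diagram \<mu> \<and> (r, c') \<in> top_diagram \<mu> \<and> c < c'
            \<longrightarrow> Z (r, c) < Z (r, c')) \<and>
        (\<forall>r r' c. (r, c) \<in> top_diagram \<mu> \<and> (r', c) \<in> top_diagram \<mu> \<and> r < r'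
            \<longrightarrow> Z (r, c) < Z (r', c)) \<and>
        (\<forall>c c'. (1, c) \<in> bottom_row k \<and> (1, c') \<in> bottom_row k \<and> c < c'
            \<longrightarrow> Z (1, c) < Z (1, c')) \<and>
        Z (1, 1) = 1}"

text \<open>
  The special column of \<open>n\<close> boxes is column 0; its box in row \<open>r\<close> is labelled \<open>r\<close>.
\<close>

definition ext_diagram :: "nat \<Rightarrow> nat \<Rightarrow> nat list \<Rightarrow> (nat \<times> nat) set" where
  "ext_diagram n k \<mu> = diagram k \<mu> \<union> {(r, c). c = 0 \<and> 1 \<le> r \<and> r \<le> n}"

definition ext_filling :: "(nat \<times> nat \<Rightarrow> nat) \<Rightarrow> nat \<times> nat \<Rightarrow> nat" where
  "ext_filling Z = (\<lambda>(r, c). if c = 0 then r else Z (r, c))"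

definition g_value :: "nat \<Rightarrow> nat \<Rightarrow> nat list \<Rightarrow> (nat \<times> nat \<Rightarrow> nat) \<Rightarrow> nat \<Rightarrow> nat" where
  "g_value n k \<mu> Z v =
     (let (j, i) = the_inv_into (diagram k \<mu>) Z v in
      if j = 1 then 1
      else card {j'. j \<le> j' \<and> (j', i - 1) \<in> ext_diagram n k \<mu> \<and> ext_filling Z (j', i - 1) \<le> v})"

definition g_index :: "nat \<Rightarrow> nat \<Rightarrow> nat list \<Rightarrow> (nat \<times> nat \<Rightarrow> nat) \<Rightarrow> nat" where
  "g_index n k \<mu> Z = (\<Prod>v = 1..n. g_value n k \<mu> Z v)"

lemma finite_diagram: "finite (diagram k \<mu>)"
proof -
  have "bottom_row k \<subseteq> {1} \<times> {1..k}"
    by (auto simp: bottom_row_def)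
  moreover have "top_diagram \<mu> \<subseteq> (SIGMA r:{2..length \<mu> + 1}. {1..\<mu> ! (r - 2)})"
    by (auto simp: top_diagram_def)
  ultimately show ?thesis
    unfolding diagram_def by (meson finite_SigmaI finite_UnI finite_atLeastAtMost
        finite.emptyI finite.insertI finite_subset)
qed

lemma finite_young_tableaux: "finite (young_tableaux n k \<mu>)"
proof (rule finite_subset)
  show "young_tableaux n k \<mu> \<subseteq> (\<Pi>\<^sub>E b \<in> diagram k \<mu>. {1..n})"
    by (auto simp: young_tableaux_def PiE_def bij_betw_def)
  show "finite (\<Pi>\<^sub>E b \<in> diagram k \<mu>. {1..n})"
    by (intro finite_PiE finite_diagram) auto
qed

end

theory Submission
  imports Defs "HOL-Library.Multiset"
begin

text \<open>
  Both sides satisfy the same recursion in \<open>n\<close>. Removing the last letter of an inversion sequence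
  either decreases \<open>k\<close> or decreases one positive part of \<open>\<mu>\<close> from \<open>c\<close> to \<open>c - 1\<close>; the letter can then
  be any of those that occur exactly \<open>c - 1\<close> times in the shorter sequence. Removing the largest
  entry of a tableau either shortens the bottom row or removes a corner of the top diagram, in
  column \<open>c\<close> say. The \<open>g\<close>-values of the other entries do not change, and the removed entry
  contributes the number of rows of length exactly \<open>c - 1\<close> that remain, which is the same factor.
\<close>

section \<open>Corners of a partition and their removal\<close>

text \<open>For a weakly decreasing list these indices are the last occurrences of the distinct
  positive parts, that is, the rows of the Ferrers diagram whose last box can be removed. Index
  \<open>i\<close> belongs to row \<open>i + 2\<close>.\<close>

definition corners :: "nat list \<Rightarrow> nat set" where
  "corners \<mu> = {i. i < length \<mu> \<and> 0 < \<mu> ! i \<and> (\<forall>j. i < j \<and> j < length \<mu> \<longrightarrow> \<mu> ! j < \<mu> ! i)}"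

abbreviation decr :: "nat list \<Rightarrow> nat \<Rightarrow> nat list" where
  "decr \<mu> i \<equiv> \<mu>[i := \<mu> ! i - 1]"

lemma finite_corners: "finite (corners \<mu>)"
  by (rule finite_subset[of _ "{..<length \<mu>}"]) (auto simp: corners_def)

text \<open>Of two different corners the later one has the strictly smaller part.\<close>

lemma inj_on_corners: "inj_on ((!) \<mu>) (corners \<mu>)"
  unfolding inj_on_def corners_def by clarsimp (metis less_irrefl linorder_neqE_nat)

text \<open>The last index carrying the value \<open>c\<close> works: later parts are at most
  \<open>c\<close> because the list is sorted, and differ from \<open>c\<close> by
  maximality.\<close>

lemma corner_exists:
  assumes "sorted_wrt (\<ge>) \<mu>" "c \<in> set \<mu>" "0 < c"
  obtains i where "i \<in> corners \<mu>" "\<mu> ! i = c"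
proof -
  define i where "i = Max {i. i < length \<mu> \<and> \<mu> ! i = c}"
  have ne: "{i. i < length \<mu> \<and> \<mu> ! i = c} \<noteq> {}"
    using assms(2) by (auto simp: in_set_conv_nth)
  have i: "i < length \<mu>" "\<mu> ! i = c"
    using Max_in[OF _ ne] unfolding i_def by auto
  have max: "j \<le> i" if "j < length \<mu>" "\<mu> ! j = c" for j
    unfolding i_def using that by (intro Max_ge) auto
  have "\<mu> ! j < \<mu> ! i" if "i < j" "j < length \<mu>" for j
  proof -
    have "\<mu> ! j \<noteq> c" using that max[of j] by auto
    moreover have "\<mu> ! j \<le> \<mu> ! i"
      using assms(1) that i by (auto simp: sorted_wrt_iff_nth_less)
    ultimately show ?thesis using i by simp
  qed
  then show ?thesis using that[of i] i assms(3) by (auto simp: corners_def)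
qed

lemma sorted_decr:
  assumes "sorted_wrt (\<ge>) \<mu>" "i \<in> corners \<mu>"
  shows "sorted_wrt (\<ge>) (decr \<mu> i)"
proof -
  have "\<mu> ! j \<le> \<mu> ! i - 1" if "i < j" "j < length \<mu>" for j
    using assms(2) that unfolding corners_def by fastforce
  moreover have "\<mu> ! i - 1 \<le> \<mu> ! j" if "j < i" "i < length \<mu>" for j
    using assms(1) that le_diff_conv trans_le_add1 by (fastforce simp: sorted_wrt_iff_nth_less)
  moreover have "i < length \<mu>" using assms(2) by (simp add: corners_def)
  ultimately show ?thesis
    using assms(1) by (auto simp: sorted_wrt_iff_nth_less nth_list_update)
qed

lemma count_list_conv_card: "count_list xs x = card {i. i < length xs \<and> xs ! i = x}"
proof -
  have "count_list xs x = length (filter (\<lambda>y. y = x) xs)" by (induction xs) auto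
  then show ?thesis by (simp add: length_filter_conv_card)
qed

lemma sum_list_decr:
  assumes "i \<in> corners \<mu>"
  shows "sum_list (decr \<mu> i) = sum_list \<mu> - 1"
  using assms by (auto simp: corners_def sum_list_update)

text \<open>If the last part were positive, all parts would be at least 1 and the sum would reach
  the length.\<close>

lemma last_zero:
  fixes \<nu> :: "nat list"
  assumes "sorted_wrt (\<ge>) \<nu>" "sum_list \<nu> < length \<nu>"
  shows "\<nu> = butlast \<nu> @ [0]"
proof (cases \<nu> rule: rev_cases)
  case Nil
  then show ?thesis using assms(2) by simp
next
  case (snoc xs x)
  have "x = 0"
  proof (rule ccontr)
    assume "x \<noteq> 0"
    then have "\<forall>y\<in>set xs. 1 \<le> y"
      using assms(1) unfolding snoc sorted_wrt_append by fastforce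
    then have "length xs \<le> sum_list xs" by (induction xs) auto
    then show False using assms(2) snoc \<open>x \<noteq> 0\<close> by simp
  qed
  then show ?thesis using snoc by simp
qed

text \<open>A type of \<open>n + 1\<close> carries \<open>n\<close> terms and a type of
  \<open>n\<close> only \<open>n - 1\<close>, so each step down the recursion drops one term; that
  term is a padding zero.\<close>

lemma is_type_butlast:
  assumes "1 \<le> k" "k \<le> n" "length \<nu> = n" "sorted_wrt (\<ge>) \<nu>" "sum_list \<nu> = n - k"
  shows "is_type n k (butlast \<nu>)" "\<nu> = butlast \<nu> @ [0]"
proof -
  show *: "\<nu> = butlast \<nu> @ [0]"
    using assms by (intro last_zero) auto
  have "sorted_wrt (\<ge>) (butlast \<nu>)" "sum_list (butlast \<nu>) = n - k"
    using assms(4,5) * by (metis sorted_wrt_append, metis sum_list.append sum_list.Cons sum_list.Nil add_0_right)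
  then show "is_type n k (butlast \<nu>)"
    using assms by (auto simp: is_type_def)
qed

lemma is_type_decr:
  assumes "is_type (Suc n) k \<mu>" "i \<in> corners \<mu>"
  shows "is_type n k (butlast (decr \<mu> i))" "decr \<mu> i = butlast (decr \<mu> i) @ [0]"
proof -
  have "0 < \<mu> ! i" "i < length \<mu>" using assms(2) by (auto simp: corners_def)
  \<comment> \<open>A positive part forces \<open>k \<le> n\<close>, so that \<open>n - k\<close> is
    a genuine difference.\<close>
  then have "0 < sum_list \<mu>" by (metis elem_le_sum_list le_zero_eq not_gr_zero)
  then have "k \<le> n" "sum_list (decr \<mu> i) = n - k"
    using assms(1) sum_list_decr[OF assms(2)] by (auto simp: is_type_def)
  then show "is_type n k (butlast (decr \<mu> i))" "decr \<mu> i = butlast (decr \<mu> i) @ [0]"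
    using assms sorted_decr[of \<mu> i] is_type_butlast[of k n "decr \<mu> i"] by (auto simp: is_type_def)
qed

lemma is_type_bottom:
  assumes "is_type (Suc n) k \<mu>" "2 \<le> k"
  shows "is_type n (k - 1) (butlast \<mu>)" "\<mu> = butlast \<mu> @ [0]"
  using assms is_type_butlast[of "k - 1" n \<mu>] by (auto simp: is_type_def)

subsection \<open>Inversion sequences\<close>

text \<open>This replaces the sorted rearrangement in the type of a sequence by an equality of
  multisets, which is easy to update when a letter is appended.\<close>

lemma rev_sort_eq_iff:
  assumes "sorted_wrt (\<ge>) \<mu>"
  shows "rev (sort L) = \<mu> \<longleftrightarrow> mset L = mset (\<mu> :: nat list)"
proof
  assume "mset L = mset \<mu>"
  moreover have "sorted (rev \<mu>)" using assms by (simp add: sorted_wrt_rev)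
  ultimately have "sort L = rev \<mu>" by (intro properties_for_sort) auto
  then show "rev (sort L) = \<mu>" by simp
qed auto

lemma type_of_seq_eq_iff:
  assumes "sorted_wrt (\<ge>) \<mu>"
  shows "type_of_seq e = (k, \<mu>) \<longleftrightarrow>
    count_list e 0 = k \<and> mset (map (count_list e) [1..<length e]) = mset \<mu>"
  unfolding type_of_seq_def using rev_sort_eq_iff[OF assms] by auto

text \<open>
  The range includes the letter \<open>length e\<close>, which cannot occur in an inversion sequence \<open>e\<close> but is
  available to the next entry.
\<close>

definition letter_counts :: "nat list \<Rightarrow> nat list" where
  "letter_counts e = map (count_list e) [1..<Suc (length e)]"

lemma inversion_sequences_less:
  assumes "e \<in> inversion_sequences n" "x \<in> set e"
  shows "x < n"
  using assms unfolding inversion_sequences_def in_set_conv_nth by fastforce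

text \<open>The additional letter \<open>n\<close> exceeds every entry of \<open>e\<close>, so its
  count is 0.\<close>

lemma mset_letter_counts:
  assumes "e \<in> inversion_sequences n" "1 \<le> n"
  shows "mset (letter_counts e) = add_mset 0 (mset (map (count_list e) [1..<length e]))"
proof -
  have "length e = n" using assms by (auto simp: inversion_sequences_def)
  moreover have "count_list e n = 0"
    using inversion_sequences_less[OF assms(1)] by (auto simp: count_list_0_iff)
  ultimately show ?thesis using assms(2) by (auto simp: letter_counts_def)
qed

lemma type_of_seq_butlast_iff:
  assumes "e \<in> inversion_sequences n" "1 \<le> n" "is_type n k (butlast \<nu>)" "\<nu> = butlast \<nu> @ [0]"
  shows "type_of_seq e = (k, butlast \<nu>) \<longleftrightarrow> count_list e 0 = k \<and> mset (letter_counts e) = mset \<nu>"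
proof -
  have "mset \<nu> = add_mset 0 (mset (butlast \<nu>))" by (subst assms(4)) simp
  then show ?thesis
    using assms(3) by (simp add: type_of_seq_eq_iff is_type_def mset_letter_counts[OF assms(1,2)])
qed

section \<open>Appending a last letter to an inversion sequence\<close>

lemma inversion_sequences_Suc:
  "bij_betw (\<lambda>(e, x). e @ [x]) (inversion_sequences n \<times> {..n}) (inversion_sequences (Suc n))"
proof (rule bij_betw_byWitness[where f' = "\<lambda>e. (butlast e, last e)"])
  show "\<forall>e\<in>inversion_sequences (Suc n). (\<lambda>(e, x). e @ [x]) (butlast e, last e) = e"
    by (auto simp: inversion_sequences_def simp flip: length_greater_0_conv)
  show "(\<lambda>(e, x). e @ [x]) ` (inversion_sequences n \<times> {..n}) \<subseteq> inversion_sequences (Suc n)"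
    by (auto simp: inversion_sequences_def nth_append)
  show "(\<lambda>e. (butlast e, last e)) ` inversion_sequences (Suc n) \<subseteq> inversion_sequences n \<times> {..n}"
  proof (rule image_subsetI, intro SigmaI)
    fix e assume "e \<in> inversion_sequences (Suc n)"
    then have e: "length e = Suc n" "\<And>i. i < Suc n \<Longrightarrow> e ! i < i + 1"
      by (auto simp: inversion_sequences_def)
    show "butlast e \<in> inversion_sequences n"
      using e by (auto simp: inversion_sequences_def nth_butlast)
    have "last e = e ! n" using e(1) by (metis diff_Suc_1 last_conv_nth list.size(3) nat.distinct(1))
    then show "last e \<in> {..n}" using e(2)[of n] by auto
  qed
qed auto

lemma finite_inversion_sequences: "finite (inversion_sequences n)"
proof (rule finite_subset)
  show "inversion_sequences n \<subseteq> {e. set e \<subseteq> {..<n} \<and> length e = n}"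
    using inversion_sequences_less by (auto simp: inversion_sequences_def)
qed (simp add: finite_lists_length_eq)

text \<open>A new 0 leaves the counts of positive letters alone, but the longer sequence has one
  more letter in its range, whence \<open>letter_counts e\<close>.\<close>

lemma type_of_seq_snoc_0:
  assumes "is_type (Suc n) k \<mu>" "e \<in> inversion_sequences n"
  shows "type_of_seq (e @ [0]) = (k, \<mu>) \<longleftrightarrow>
    count_list e 0 = k - 1 \<and> mset (letter_counts e) = mset \<mu>"
proof -
  have "map (count_list (e @ [0])) [1..<length (e @ [0])] = letter_counts e"
    by (auto simp: letter_counts_def)
  then show ?thesis
    using assms(1) type_of_seq_eq_iff[of \<mu> "e @ [0]" k] by (auto simp: is_type_def)
qed

text \<open>Raising one letter count must turn the counts of \<open>e\<close> into the parts of
  \<mu>. Undoing this lowers a part equal to the raised count, and the corner with that part is the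
  canonical choice that keeps the list sorted.\<close>

lemma type_of_seq_snoc_Suc:
  assumes "is_type (Suc n) k \<mu>" "e \<in> inversion_sequences n" "y < n"
  shows "type_of_seq (e @ [Suc y]) = (k, \<mu>) \<longleftrightarrow>
    (\<exists>i\<in>corners \<mu>. (count_list e 0 = k \<and> mset (letter_counts e) = mset (decr \<mu> i)) \<and>
       letter_counts e ! y = \<mu> ! i - 1)" (is "_ \<longleftrightarrow> ?R")
proof -
  let ?L = "letter_counts e"
  have len: "length ?L = n" using assms(2) by (auto simp: letter_counts_def inversion_sequences_def)
  \<comment> \<open>The list of counts starts with letter 1, so the letter \<open>Suc y\<close> has
    index \<open>y\<close>.\<close>
  have "map (count_list (e @ [Suc y])) [1..<length (e @ [Suc y])] = ?L[y := ?L ! y + 1]"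
    using assms(2,3)
    by (intro nth_equalityI)
      (auto simp: letter_counts_def inversion_sequences_def nth_list_update simp del: upt_Suc)
  then have *: "type_of_seq (e @ [Suc y]) = (k, \<mu>) \<longleftrightarrow>
      count_list e 0 = k \<and> mset (?L[y := ?L ! y + 1]) = mset \<mu>"
    using assms(1) type_of_seq_eq_iff[of \<mu> "e @ [Suc y]" k] by (auto simp: is_type_def)
  have sorted: "sorted_wrt (\<ge>) \<mu>" using assms(1) by (simp add: is_type_def)
  have upd: "mset (?L[y := ?L ! y + 1]) = add_mset (?L ! y + 1) (mset ?L - {#?L ! y#})"
    using assms(3) len by (intro mset_update) auto
  have in_L: "?L ! y \<in># mset ?L" using assms(3) len by simp
  have decr: "mset (decr \<mu> i) = add_mset (\<mu> ! i - 1) (mset \<mu> - {#\<mu> ! i#})"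
    "\<mu> ! i \<in># mset \<mu>" "0 < \<mu> ! i" if "i \<in> corners \<mu>" for i
    using that mset_update[of i \<mu> "\<mu> ! i - 1"] by (auto simp: corners_def)
  have "mset (?L[y := ?L ! y + 1]) = mset \<mu> \<longleftrightarrow>
      (\<exists>i\<in>corners \<mu>. mset ?L = mset (decr \<mu> i) \<and> ?L ! y = \<mu> ! i - 1)"
  proof
    assume eq: "mset (?L[y := ?L ! y + 1]) = mset \<mu>"
    then have "?L ! y + 1 \<in># mset \<mu>" using upd by (metis union_single_eq_member)
    \<comment> \<open>The raised count is a positive part of \<mu>, hence the part at some
      corner.\<close>
    then obtain i where i: "i \<in> corners \<mu>" "\<mu> ! i = ?L ! y + 1"
      using corner_exists[OF sorted, of "?L ! y + 1"] by auto
    have "mset (decr \<mu> i) = add_mset (?L ! y) (mset ?L - {#?L ! y#})"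
      using decr(1)[OF i(1)] i(2) eq upd by (metis add_diff_cancel_right' add_mset_remove_trivial)
    then show "\<exists>i\<in>corners \<mu>. mset ?L = mset (decr \<mu> i) \<and> ?L ! y = \<mu> ! i - 1"
      using i in_L by (intro bexI[of _ i]) auto
  next
    assume "\<exists>i\<in>corners \<mu>. mset ?L = mset (decr \<mu> i) \<and> ?L ! y = \<mu> ! i - 1"
    then obtain i where i: "i \<in> corners \<mu>" "mset ?L = mset (decr \<mu> i)" "?L ! y = \<mu> ! i - 1" by auto
    have "mset (?L[y := ?L ! y + 1]) = add_mset (\<mu> ! i) (mset \<mu> - {#\<mu> ! i#})"
      using upd i decr[OF i(1)] by simp
    then show "mset (?L[y := ?L ! y + 1]) = mset \<mu>" using decr(2)[OF i(1)] by simp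
  qed
  then show ?thesis using * by auto
qed

text \<open>The first entry can only be 0. This rules out a final 0 when
  \<open>k = 1\<close>.\<close>

lemma count_zero_pos:
  assumes "e \<in> inversion_sequences n" "1 \<le> n"
  shows "count_list e 0 \<noteq> 0"
proof -
  have "e ! 0 = 0" "0 < length e"
    using assms by (auto simp: inversion_sequences_def dest!: spec[of _ 0])
  then have "0 \<in> set e" by (metis nth_mem)
  then show ?thesis by (simp add: count_list_0_iff)
qed

text \<open>Corner \<open>i\<close> contributes only if the letter counts of \<open>e\<close> form
  \<open>decr \<mu> i\<close> as a multiset; the admissible letters are then those with count
  \<open>\<mu> ! i - 1\<close>, and their number can be read off
  \<open>decr \<mu> i\<close>.\<close>

lemma card_snoc_Suc:
  assumes "is_type (Suc n) k \<mu>" "e \<in> inversion_sequences n" "1 \<le> n"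
  shows "card {y\<in>{..<n}. type_of_seq (e @ [Suc y]) = (k, \<mu>)} =
    (\<Sum>i\<in>corners \<mu>. if type_of_seq e = (k, butlast (decr \<mu> i))
       then count_list (decr \<mu> i) (\<mu> ! i - 1) else 0)"
proof -
  let ?L = "letter_counts e"
  let ?P = "\<lambda>i. count_list e 0 = k \<and> mset ?L = mset (decr \<mu> i)"
  have len: "length ?L = n" using assms(2) by (auto simp: letter_counts_def inversion_sequences_def)
  have "{y\<in>{..<n}. type_of_seq (e @ [Suc y]) = (k, \<mu>)} =
      (\<Union>i\<in>corners \<mu>. {y. ?P i \<and> y < n \<and> ?L ! y = \<mu> ! i - 1})"
    using type_of_seq_snoc_Suc[OF assms(1,2)] by auto
  then have "card {y\<in>{..<n}. type_of_seq (e @ [Suc y]) = (k, \<mu>)} =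
      card (\<Union>i\<in>corners \<mu>. {y. ?P i \<and> y < n \<and> ?L ! y = \<mu> ! i - 1})"
    by (rule arg_cong[where f = card])
  also have "\<dots> = (\<Sum>i\<in>corners \<mu>. card {y. ?P i \<and> y < n \<and> ?L ! y = \<mu> ! i - 1})"
  proof (rule card_UN_disjoint)
    show "\<forall>i\<in>corners \<mu>. \<forall>j\<in>corners \<mu>. i \<noteq> j \<longrightarrow>
      {y. ?P i \<and> y < n \<and> ?L ! y = \<mu> ! i - 1} \<inter> {y. ?P j \<and> y < n \<and> ?L ! y = \<mu> ! j - 1} = {}"
    proof (intro ballI impI)
      fix i j assume ij: "i \<in> corners \<mu>" "j \<in> corners \<mu>" "i \<noteq> j"
      then have "\<mu> ! i \<noteq> \<mu> ! j" using inj_on_corners by (metis inj_onD)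
      \<comment> \<open>Parts at corners are positive, so truncated subtraction keeps them
        distinct.\<close>
      then have "\<mu> ! i - 1 \<noteq> \<mu> ! j - 1" using ij by (auto simp: corners_def)
      then show "{y. ?P i \<and> y < n \<and> ?L ! y = \<mu> ! i - 1} \<inter> {y. ?P j \<and> y < n \<and> ?L ! y = \<mu> ! j - 1} = {}"
        by auto
    qed
    show "\<forall>i\<in>corners \<mu>. finite {y. ?P i \<and> y < n \<and> ?L ! y = \<mu> ! i - 1}"
      by (rule ballI, rule finite_Collect_conjI, rule disjI2, rule finite_Collect_conjI, rule disjI1,
          rule finite_Collect_less_nat)
  qed (rule finite_corners)
  also have "\<dots> = (\<Sum>i\<in>corners \<mu>. if type_of_seq e = (k, butlast (decr \<mu> i))
       then count_list (decr \<mu> i) (\<mu> ! i - 1) else 0)"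
  proof (rule sum.cong[OF refl])
    fix i assume i: "i \<in> corners \<mu>"
    have iff: "type_of_seq e = (k, butlast (decr \<mu> i)) \<longleftrightarrow> ?P i"
      using type_of_seq_butlast_iff[OF assms(2,3) is_type_decr[OF assms(1) i]] .
    have eq: "card {y. y < n \<and> ?L ! y = \<mu> ! i - 1} = count_list (decr \<mu> i) (\<mu> ! i - 1)" if "?P i"
      using mset_eq_length_filter[OF conjunct2[OF that]] count_list_conv_card[of ?L "\<mu> ! i - 1"]
      unfolding len by metis
    show "card {y. ?P i \<and> y < n \<and> ?L ! y = \<mu> ! i - 1} =
       (if type_of_seq e = (k, butlast (decr \<mu> i)) then count_list (decr \<mu> i) (\<mu> ! i - 1) else 0)"
      unfolding iff using eq by (cases "?P i") (simp, auto)
  qed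
  finally show ?thesis .
qed

lemma p_num_Suc:
  assumes "is_type (Suc n) k \<mu>" "1 \<le> n"
  shows "p_num (Suc n) k \<mu> = (if 2 \<le> k then p_num n (k - 1) (butlast \<mu>) else 0) +
    (\<Sum>i\<in>corners \<mu>. count_list (decr \<mu> i) (\<mu> ! i - 1) * p_num n k (butlast (decr \<mu> i)))"
proof -
  let ?I = "inversion_sequences n"
  have k: "1 \<le> k" using assms(1) by (simp add: is_type_def)
  have "p_num (Suc n) k \<mu> =
      card {p \<in> ?I \<times> {..n}. type_of_seq (case p of (e, x) \<Rightarrow> e @ [x]) = (k, \<mu>)}"
    unfolding p_num_def
    by (rule bij_betw_same_card[OF bij_betw_Collect[OF inversion_sequences_Suc], symmetric]) simp
  also have "{p \<in> ?I \<times> {..n}. type_of_seq (case p of (e, x) \<Rightarrow> e @ [x]) = (k, \<mu>)} =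
      (SIGMA e:?I. {x\<in>{..n}. type_of_seq (e @ [x]) = (k, \<mu>)})" by auto
  also have "card \<dots> = (\<Sum>e\<in>?I. card {x\<in>{..n}. type_of_seq (e @ [x]) = (k, \<mu>)})"
    by (intro card_SigmaI) (auto simp: finite_inversion_sequences)
  also have "\<dots> = (\<Sum>e\<in>?I. (if 2 \<le> k \<and> type_of_seq e = (k - 1, butlast \<mu>) then 1 else 0) +
    (\<Sum>i\<in>corners \<mu>. if type_of_seq e = (k, butlast (decr \<mu> i))
       then count_list (decr \<mu> i) (\<mu> ! i - 1) else 0))"
  proof (rule sum.cong[OF refl])
    fix e assume e: "e \<in> ?I"
    \<comment> \<open>The letter 0 changes \<open>k\<close>, the positive letters change \<mu>; they
      are counted separately.\<close>
    have "{x\<in>{..n}. type_of_seq (e @ [x]) = (k, \<mu>)} =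
       (if type_of_seq (e @ [0]) = (k, \<mu>) then {0} else {}) \<union>
       Suc ` {y\<in>{..<n}. type_of_seq (e @ [Suc y]) = (k, \<mu>)}"
      by (auto simp: image_iff split: nat.splits) (metis Suc_le_lessD not0_implies_Suc)+
    also have "card \<dots> = (if type_of_seq (e @ [0]) = (k, \<mu>) then 1 else 0) +
       card {y\<in>{..<n}. type_of_seq (e @ [Suc y]) = (k, \<mu>)}"
      by (subst card_Un_disjoint) (auto simp: card_image)
    also have "type_of_seq (e @ [0]) = (k, \<mu>) \<longleftrightarrow> 2 \<le> k \<and> type_of_seq e = (k - 1, butlast \<mu>)"
    proof (cases "2 \<le> k")
      case True
      show ?thesis
        using type_of_seq_snoc_0[OF assms(1) e] True
          type_of_seq_butlast_iff[OF e assms(2) is_type_bottom[OF assms(1) True]] by simp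
    next
      \<comment> \<open>Here \<open>k = 1\<close>, and a final 0 would leave a shorter sequence
        without any 0.\<close>
      case False
      then show ?thesis
        using type_of_seq_snoc_0[OF assms(1) e] count_zero_pos[OF e assms(2)] k by auto
    qed
    finally show "card {x\<in>{..n}. type_of_seq (e @ [x]) = (k, \<mu>)} =
      (if 2 \<le> k \<and> type_of_seq e = (k - 1, butlast \<mu>) then 1 else 0) +
      (\<Sum>i\<in>corners \<mu>. if type_of_seq e = (k, butlast (decr \<mu> i))
       then count_list (decr \<mu> i) (\<mu> ! i - 1) else 0)"
      by (simp only: card_snoc_Suc[OF assms(1) e assms(2)])
  qed
  \<comment> \<open>Exchanging the sums lets each corner collect all shorter sequences of its
    type.\<close>
  also have "\<dots> = (\<Sum>e\<in>?I. if 2 \<le> k \<and> type_of_seq e = (k - 1, butlast \<mu>) then 1 else 0) +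
    (\<Sum>i\<in>corners \<mu>. \<Sum>e\<in>?I. if type_of_seq e = (k, butlast (decr \<mu> i))
       then count_list (decr \<mu> i) (\<mu> ! i - 1) else 0)"
    unfolding sum.distrib by (subst (2) sum.swap) simp
  also have "(\<Sum>e\<in>?I. if 2 \<le> k \<and> type_of_seq e = (k - 1, butlast \<mu>) then 1 else 0) =
      (if 2 \<le> k then p_num n (k - 1) (butlast \<mu>) else 0)"
    by (auto simp: p_num_def finite_inversion_sequences sum.If_cases Int_def)
  also have "(\<Sum>i\<in>corners \<mu>. \<Sum>e\<in>?I. if type_of_seq e = (k, butlast (decr \<mu> i))
       then count_list (decr \<mu> i) (\<mu> ! i - 1) else 0) =
     (\<Sum>i\<in>corners \<mu>. count_list (decr \<mu> i) (\<mu> ! i - 1) * p_num n k (butlast (decr \<mu> i)))"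
    by (intro sum.cong)
      (auto simp: p_num_def finite_inversion_sequences sum.If_cases Int_def)
  finally show ?thesis .
qed

subsection \<open>Tableaux\<close>

lemma young_tableauxD:
  assumes "Z \<in> young_tableaux n k \<mu>"
  shows "Z \<in> extensional (diagram k \<mu>)" "bij_betw Z (diagram k \<mu>) {1..n}" "Z (1, 1) = 1"
    "\<And>r c c'. (r, c) \<in> top_diagram \<mu> \<Longrightarrow> (r, c') \<in> top_diagram \<mu> \<Longrightarrow> c < c' \<Longrightarrow> Z (r, c) < Z (r, c')"
    "\<And>r r' c. (r, c) \<in> top_diagram \<mu> \<Longrightarrow> (r', c) \<in> top_diagram \<mu> \<Longrightarrow> r < r' \<Longrightarrow> Z (r, c) < Z (r', c)"
    "\<And>c c'. (1, c) \<in> bottom_row k \<Longrightarrow> (1, c') \<in> bottom_row k \<Longrightarrow> c < c' \<Longrightarrow> Z (1, c) < Z (1, c')"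
  using assms unfolding young_tableaux_def by blast+

lemma young_tableauxI:
  assumes "Z \<in> extensional (diagram k \<mu>)" "bij_betw Z (diagram k \<mu>) {1..n}" "Z (1, 1) = 1"
    "\<And>r c c'. (r, c) \<in> top_diagram \<mu> \<Longrightarrow> (r, c') \<in> top_diagram \<mu> \<Longrightarrow> c < c' \<Longrightarrow> Z (r, c) < Z (r, c')"
    "\<And>r r' c. (r, c) \<in> top_diagram \<mu> \<Longrightarrow> (r', c) \<in> top_diagram \<mu> \<Longrightarrow> r < r' \<Longrightarrow> Z (r, c) < Z (r', c)"
    "\<And>c c'. (1, c) \<in> bottom_row k \<Longrightarrow> (1, c') \<in> bottom_row k \<Longrightarrow> c < c' \<Longrightarrow> Z (1, c) < Z (1, c')"
  shows "Z \<in> young_tableaux n k \<mu>"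
  using assms unfolding young_tableaux_def by blast

section \<open>Removing and restoring the box of the largest entry\<close>

text \<open>This is the \<open>g_value\<close> of the largest entry when it sits in box
  \<open>b\<close>: the bound on the entries to be counted is then vacuous, so only the shape
  matters.\<close>

definition box_weight :: "nat \<Rightarrow> nat \<Rightarrow> nat list \<Rightarrow> nat \<times> nat \<Rightarrow> nat" where
  "box_weight n k \<mu> b = (if fst b = 1 then 1
     else card {j. fst b \<le> j \<and> (j, snd b - 1) \<in> ext_diagram n k \<mu>})"

text \<open>A common frame for the end of the bottom row and the corners of the top diagram, with
  \<open>k'\<close> and \<open>\<mu>'\<close> describing the shape without \<open>b\<close>. The
  maximality conditions say that no box to the right of \<open>b\<close>, or above it in the top
  diagram, has to carry a larger entry.\<close>

locale removable_box =
  fixes n k :: nat and \<mu> :: "nat list" and b :: "nat \<times> nat" and k' :: nat and \<mu>' :: "nat list"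
  assumes b_in: "b \<in> diagram k \<mu>" and b_ne: "b \<noteq> (1, 1)" and k_pos: "1 \<le> k"
    and bottom: "bottom_row k' = bottom_row k - {b}"
    and top: "top_diagram \<mu>' = top_diagram \<mu> - {b}"
    and bottom_max: "\<And>c. b \<in> bottom_row k \<Longrightarrow> (1, c) \<in> bottom_row k \<Longrightarrow> c \<le> snd b"
    and row_max: "\<And>c. b \<in> top_diagram \<mu> \<Longrightarrow> (fst b, c) \<in> top_diagram \<mu> \<Longrightarrow> c \<le> snd b"
    and col_max: "\<And>r. b \<in> top_diagram \<mu> \<Longrightarrow> (r, snd b) \<in> top_diagram \<mu> \<Longrightarrow> r \<le> fst b"
begin

lemma diagram_remove: "diagram k' \<mu>' = diagram k \<mu> - {b}"
  unfolding diagram_def bottom top by blast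

lemma first_box_in: "(1, 1) \<in> diagram k' \<mu>'"
  using b_ne k_pos unfolding diagram_remove by (auto simp: diagram_def bottom_row_def)

lemma restrict_tableau:
  assumes Z: "Z \<in> young_tableaux (Suc n) k \<mu>" "Z b = Suc n"
  shows "restrict Z (diagram k' \<mu>') \<in> young_tableaux n k' \<mu>'"
proof -
  note Y = young_tableauxD[OF Z(1)]
  have "bij_betw Z (diagram k \<mu> - {b}) ({1..Suc n} - {Z b})"
    using b_in bij_betwE[OF Y(2)] by (intro bij_betw_DiffI[OF Y(2) bij_betw_singletonI]) auto
  moreover have "{1..Suc n} - {Z b} = {1..n}" using Z(2) by auto
  ultimately have bij: "bij_betw Z (diagram k' \<mu>') {1..n}" by (simp add: diagram_remove)
  have inT: "p \<in> diagram k' \<mu>'" "p \<in> top_diagram \<mu>" if "p \<in> top_diagram \<mu>'" for p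
    using that top by (auto simp: diagram_def)
  have inB: "p \<in> diagram k' \<mu>'" "p \<in> bottom_row k" if "p \<in> bottom_row k'" for p
    using that bottom by (auto simp: diagram_def)
  show ?thesis
  proof (rule young_tableauxI)
    show "bij_betw (restrict Z (diagram k' \<mu>')) (diagram k' \<mu>') {1..n}"
      using bij by (simp cong: bij_betw_cong)
    show "restrict Z (diagram k' \<mu>') (1, 1) = 1" using first_box_in Y(3) by simp
    show "restrict Z (diagram k' \<mu>') (r, c) < restrict Z (diagram k' \<mu>') (r, c')"
      if "(r, c) \<in> top_diagram \<mu>'" "(r, c') \<in> top_diagram \<mu>'" "c < c'" for r c c'
      using that Y(4)[of r c c'] inT by simp
    show "restrict Z (diagram k' \<mu>') (r, c) < restrict Z (diagram k' \<mu>') (r', c)"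
      if "(r, c) \<in> top_diagram \<mu>'" "(r', c) \<in> top_diagram \<mu>'" "r < r'" for r r' c
      using that Y(5)[of r c r'] inT by simp
    show "restrict Z (diagram k' \<mu>') (1, c) < restrict Z (diagram k' \<mu>') (1, c')"
      if "(1, c) \<in> bottom_row k'" "(1, c') \<in> bottom_row k'" "c < c'" for c c'
      using that Y(6)[of c c'] inB by simp
  qed simp
qed

text \<open>The new entry exceeds all others, and \<open>b\<close> is never the smaller box in a
  comparison, so every order condition survives.\<close>

lemma extend_tableau:
  assumes Z: "Z \<in> young_tableaux n k' \<mu>'"
  shows "Z(b := Suc n) \<in> young_tableaux (Suc n) k \<mu>"
proof -
  note Y = young_tableauxD[OF Z]
  have le: "Z p < Suc n" if "p \<in> diagram k' \<mu>'" for p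
    using bij_betwE[OF Y(2)] that by fastforce
  have "bij_betw (Z(b := Suc n)) (diagram k' \<mu>') {1..n}"
    using Y(2) by (rule bij_betw_cong[THEN iffD1, rotated]) (auto simp: diagram_remove)
  then have "bij_betw (Z(b := Suc n)) (insert b (diagram k' \<mu>')) (insert (Suc n) {1..n})"
    using notIn_Un_bij_betw3[of b "diagram k' \<mu>'" "Z(b := Suc n)" "{1..n}"]
    by (simp add: diagram_remove)
  moreover have "insert b (diagram k' \<mu>') = diagram k \<mu>" "insert (Suc n) {1..n} = {1..Suc n}"
    using b_in by (auto simp: diagram_remove)
  ultimately have bij: "bij_betw (Z(b := Suc n)) (diagram k \<mu>) {1..Suc n}" by simp
  have T: "p \<in> top_diagram \<mu>'" "Z p < Suc n" if "p \<in> top_diagram \<mu>" "p \<noteq> b" for p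
    using that le[of p] top by (auto simp: diagram_def)
  have B: "p \<in> bottom_row k'" "Z p < Suc n" if "p \<in> bottom_row k" "p \<noteq> b" for p
    using that le[of p] bottom by (auto simp: diagram_def)
  show ?thesis
  proof (rule young_tableauxI)
    show "Z(b := Suc n) \<in> extensional (diagram k \<mu>)"
      using Y(1) b_in by (auto simp: extensional_def diagram_remove)
    show "bij_betw (Z(b := Suc n)) (diagram k \<mu>) {1..Suc n}" by (rule bij)
    show "(Z(b := Suc n)) (1, 1) = 1" using b_ne Y(3) by simp
    fix r c c' assume *: "(r, c) \<in> top_diagram \<mu>" "(r, c') \<in> top_diagram \<mu>" "c < c'"
    have "(r, c) \<noteq> b" using row_max[of c'] * by auto
    then show "(Z(b := Suc n)) (r, c) < (Z(b := Suc n)) (r, c')"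
      using * T Y(4)[of r c c'] by (cases "(r, c') = b") auto
  next
    fix r r' c assume *: "(r, c) \<in> top_diagram \<mu>" "(r', c) \<in> top_diagram \<mu>" "r < r'"
    have "(r, c) \<noteq> b" using col_max[of r'] * by auto
    then show "(Z(b := Suc n)) (r, c) < (Z(b := Suc n)) (r', c)"
      using * T Y(5)[of r c r'] by (cases "(r', c) = b") auto
  next
    fix c c' assume *: "(1, c) \<in> bottom_row k" "(1, c') \<in> bottom_row k" "c < c'"
    have "(1, c) \<noteq> b" using bottom_max[of c'] * by auto
    then show "(Z(b := Suc n)) (1, c) < (Z(b := Suc n)) (1, c')"
      using * B Y(6)[of c c'] by (cases "(1, c') = b") auto
  qed
qed

lemma g_value_last:
  assumes Z: "Z \<in> young_tableaux (Suc n) k \<mu>" "Z b = Suc n"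
  shows "g_value (Suc n) k \<mu> Z (Suc n) = box_weight (Suc n) k \<mu> b"
proof -
  note bij = young_tableauxD(2)[OF Z(1)]
  have "the_inv_into (diagram k \<mu>) Z (Suc n) = b"
    using bij b_in Z(2) by (intro the_inv_into_f_eq) (auto simp: bij_betw_def)
  \<comment> \<open>The labels of column 0 obey this bound as well.\<close>
  moreover have "ext_filling Z p \<le> Suc n" if "p \<in> ext_diagram (Suc n) k \<mu>" for p
    using bij_betwE[OF bij] that
    by (cases p) (auto simp: ext_diagram_def ext_filling_def diagram_def bottom_row_def top_diagram_def)
  ultimately show ?thesis
    unfolding g_value_def box_weight_def
    by (auto simp: Let_def split: prod.split intro!: arg_cong[where f = card])
qed

text \<open>The larger tableau has just two further boxes, \<open>b\<close> and the top box of
  column 0. Both carry \<open>Suc n\<close>, which exceeds \<open>v\<close>, so neither is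
  counted.\<close>

lemma g_value_restrict:
  assumes Z: "Z \<in> young_tableaux (Suc n) k \<mu>" "Z b = Suc n" and v: "v \<in> {1..n}"
  shows "g_value (Suc n) k \<mu> Z v = g_value n k' \<mu>' (restrict Z (diagram k' \<mu>')) v"
proof -
  let ?Z' = "restrict Z (diagram k' \<mu>')"
  note bij = young_tableauxD(2)[OF Z(1)]
  note bij' = young_tableauxD(2)[OF restrict_tableau[OF Z]]
  obtain p where p: "p \<in> diagram k' \<mu>'" "?Z' p = v"
    using bij' v by (metis bij_betw_imp_surj_on imageE)
  have "the_inv_into (diagram k' \<mu>') ?Z' v = p"
    using bij' p by (intro the_inv_into_f_eq) (auto simp: bij_betw_def)
  moreover have "the_inv_into (diagram k \<mu>) Z v = p"
    using bij p by (intro the_inv_into_f_eq) (auto simp: bij_betw_def diagram_remove)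
  moreover have iff: "q \<in> ext_diagram (Suc n) k \<mu> \<and> ext_filling Z q \<le> v \<longleftrightarrow>
      q \<in> ext_diagram n k' \<mu>' \<and> ext_filling ?Z' q \<le> v" for q
  proof (cases "snd q = 0")
    case True
    then have "q \<notin> diagram k \<mu>" by (auto simp: diagram_def bottom_row_def top_diagram_def)
    then show ?thesis
      using True v by (cases q) (auto simp: ext_diagram_def ext_filling_def diagram_remove)
  next
    case False
    then show ?thesis
      using v Z(2) by (cases q) (auto simp: ext_diagram_def ext_filling_def diagram_remove)
  qed
  ultimately show ?thesis unfolding g_value_def iff by simp
qed

lemma g_index_restrict:
  assumes Z: "Z \<in> young_tableaux (Suc n) k \<mu>" "Z b = Suc n"
  shows "g_index (Suc n) k \<mu> Z =
    box_weight (Suc n) k \<mu> b * g_index n k' \<mu>' (restrict Z (diagram k' \<mu>'))"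
  using g_value_restrict[OF Z] g_value_last[OF Z] by (simp add: g_index_def mult.commute)

text \<open>Restriction to the smaller diagram and insertion of \<open>Suc n\<close> at
  \<open>b\<close> are mutually inverse, and the weight of \<open>b\<close> splits off as a constant
  factor.\<close>

lemma sum_g_index:
  "(\<Sum>Z | Z \<in> young_tableaux (Suc n) k \<mu> \<and> Z b = Suc n. g_index (Suc n) k \<mu> Z) =
   box_weight (Suc n) k \<mu> b * (\<Sum>Z\<in>young_tableaux n k' \<mu>'. g_index n k' \<mu>' Z)"
  unfolding sum_distrib_left
proof (rule sum.reindex_bij_witness[where i = "\<lambda>Z. Z(b := Suc n)"
      and j = "\<lambda>Z. restrict Z (diagram k' \<mu>')"], goal_cases)
  case (1 Z)
  then show ?case
    using young_tableauxD(1)[of Z] by (auto simp: fun_eq_iff diagram_remove extensional_def)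
next
  case (2 Z)
  then show ?case using restrict_tableau by auto
next
  case (3 Z)
  then show ?case
    using young_tableauxD(1)[of Z] by (auto simp: fun_eq_iff diagram_remove extensional_def)
next
  case (4 Z)
  then show ?case using extend_tableau by auto
next
  case (5 Z)
  then show ?case using g_index_restrict by simp
qed

end

section \<open>The boxes that can hold the largest entry, and their weights\<close>

abbreviation corner_box :: "nat list \<Rightarrow> nat \<Rightarrow> nat \<times> nat" where
  "corner_box \<mu> i \<equiv> (i + 2, \<mu> ! i)"

lemma top_diagram_append_0: "top_diagram (\<nu> @ [0]) = top_diagram \<nu>"
  by (auto simp: top_diagram_def nth_append split: if_splits)

lemma bottom_row_remove: "bottom_row (k - 1) = bottom_row k - {(1, k)}"
proof (intro set_eqI)
  fix p
  show "p \<in> bottom_row (k - 1) \<longleftrightarrow> p \<in> bottom_row k - {(1, k)}"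
    unfolding bottom_row_def by (cases p) (simp, arith)
qed

lemma removable_bottom:
  assumes "is_type (Suc n) k \<mu>" "2 \<le> k"
  shows "removable_box k \<mu> (1, k) (k - 1) (butlast \<mu>)"
proof (rule removable_box.intro)
  have "top_diagram \<mu> = top_diagram (butlast \<mu> @ [0])"
    by (rule arg_cong[OF is_type_bottom(2)[OF assms]])
  then have "top_diagram (butlast \<mu>) = top_diagram \<mu>" by (simp only: top_diagram_append_0)
  then show "top_diagram (butlast \<mu>) = top_diagram \<mu> - {(1, k)}"
    by (simp add: top_diagram_def)
  show "bottom_row (k - 1) = bottom_row k - {(1, k)}" by (rule bottom_row_remove)
  show "(1, k) \<in> diagram k \<mu>" using assms(2) by (simp add: diagram_def bottom_row_def)
  show "(1, k) \<noteq> (1, 1)" "1 \<le> k" using assms(2) by simp_all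
  show "c \<le> snd (1, k)" if "(1, c) \<in> bottom_row k" for c
    using that by (simp add: bottom_row_def)
  \<comment> \<open>The row and column conditions concern only the top diagram and hold
    vacuously.\<close>
  have "(1, c) \<notin> top_diagram \<mu>" for c by (simp add: top_diagram_def)
  then show "c \<le> snd (1, k)" "c \<le> fst (1, k)" if "(1, k) \<in> top_diagram \<mu>" for c
    using that by blast+
qed

lemma removable_corner:
  assumes "is_type (Suc n) k \<mu>" "i \<in> corners \<mu>"
  shows "removable_box k \<mu> (corner_box \<mu> i) k (butlast (decr \<mu> i))"
proof
  have i: "i < length \<mu>" "0 < \<mu> ! i" and less: "\<And>j. i < j \<Longrightarrow> j < length \<mu> \<Longrightarrow> \<mu> ! j < \<mu> ! i"
    using assms(2) by (auto simp: corners_def)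
  show "corner_box \<mu> i \<in> diagram k \<mu>"
    using i by (auto simp: diagram_def top_diagram_def)
  show "1 \<le> k" using assms(1) by (simp add: is_type_def)
  have "top_diagram (decr \<mu> i) = top_diagram (butlast (decr \<mu> i) @ [0])"
    by (rule arg_cong[OF is_type_decr(2)[OF assms]])
  then have "top_diagram (butlast (decr \<mu> i)) = top_diagram (decr \<mu> i)"
    by (simp only: top_diagram_append_0)
  also have "\<dots> = top_diagram \<mu> - {corner_box \<mu> i}"
    using i by (auto simp: top_diagram_def nth_list_update split: if_splits)
  finally show "top_diagram (butlast (decr \<mu> i)) = top_diagram \<mu> - {corner_box \<mu> i}" .
  \<comment> \<open>Rows above the corner are strictly shorter and do not reach its column.\<close>
  show "r \<le> fst (corner_box \<mu> i)" if "(r, snd (corner_box \<mu> i)) \<in> top_diagram \<mu>" for r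
    using that less[of "r - 2"] by (force simp: top_diagram_def)
qed (auto simp: bottom_row_def top_diagram_def)

text \<open>Let \<open>c = \<mu> ! i\<close>. Rows above the corner have fewer than \<open>c\<close>
  boxes, so those reaching column \<open>c - 1\<close> have length exactly \<open>c - 1\<close>. The
  corner row itself attains this length in \<open>decr \<mu> i\<close>, while the rows below it have
  length at least \<open>c\<close>.\<close>

lemma box_weight_corner:
  assumes "is_type (Suc n) k \<mu>" "i \<in> corners \<mu>"
  shows "box_weight (Suc n) k \<mu> (corner_box \<mu> i) = count_list (decr \<mu> i) (\<mu> ! i - 1)"
proof -
  have i: "i < length \<mu>" "0 < \<mu> ! i" and less: "\<And>j. i < j \<Longrightarrow> j < length \<mu> \<Longrightarrow> \<mu> ! j < \<mu> ! i"
    using assms(2) by (auto simp: corners_def)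
  have len: "length \<mu> = n" and ge: "\<And>j. j < i \<Longrightarrow> \<mu> ! i \<le> \<mu> ! j"
    using assms(1) i by (auto simp: is_type_def sorted_wrt_iff_nth_less)
  have "{j. i + 2 \<le> j \<and> (j, \<mu> ! i - 1) \<in> ext_diagram (Suc n) k \<mu>} =
      (\<lambda>j. j + 2) ` {j. j < length (decr \<mu> i) \<and> decr \<mu> i ! j = \<mu> ! i - 1}" (is "?A = _ ` ?B")
  proof -
    have B: "?B = {j. i \<le> j \<and> j < n \<and> \<mu> ! i - 1 \<le> \<mu> ! j}"
    proof (intro Collect_cong iffI)
      fix j assume j: "j < length (decr \<mu> i) \<and> decr \<mu> i ! j = \<mu> ! i - 1"
      then have "i \<le> j"
        using ge[of j] i by (cases "j < i") (auto simp: nth_list_update)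
      then show "i \<le> j \<and> j < n \<and> \<mu> ! i - 1 \<le> \<mu> ! j"
        using j len by (auto simp: nth_list_update split: if_splits)
    next
      fix j assume "i \<le> j \<and> j < n \<and> \<mu> ! i - 1 \<le> \<mu> ! j"
      then show "j < length (decr \<mu> i) \<and> decr \<mu> i ! j = \<mu> ! i - 1"
        using less[of j] len by (cases "j = i") (auto simp: nth_list_update)
    qed
    \<comment> \<open>For \<open>\<mu> ! i = 1\<close> the boxes lie in column 0, whose rows 2 to
      \<open>n + 1\<close> match the \<open>n\<close> indices of \<mu>, zero parts included.\<close>
    have A: "j \<in> ?A \<longleftrightarrow> i + 2 \<le> j \<and> j - 2 < n \<and> \<mu> ! i - 1 \<le> \<mu> ! (j - 2)" for j
      using len i
      by (auto simp: ext_diagram_def diagram_def bottom_row_def top_diagram_def)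
    show ?thesis
    proof (intro set_eqI iffI)
      fix j assume "j \<in> ?A"
      then show "j \<in> (\<lambda>j. j + 2) ` ?B"
        unfolding A B by (intro image_eqI[of _ _ "j - 2"]) auto
    qed (unfold A B, auto)
  qed
  then have "box_weight (Suc n) k \<mu> (corner_box \<mu> i) = card ((\<lambda>j. j + 2) ` ?B)"
    by (simp add: box_weight_def)
  also have "\<dots> = card ?B" by (intro card_image inj_onI) simp
  finally have "box_weight (Suc n) k \<mu> (corner_box \<mu> i) = card ?B" .
  then show ?thesis
    by (simp add: count_list_conv_card)
qed

text \<open>No entry exceeds \<open>Suc n\<close>, so its box ends its row and, in the top diagram,
  its column as well; there it is a corner.\<close>

lemma position_of_last:
  assumes "is_type (Suc n) k \<mu>" "1 \<le> n" "Z \<in> young_tableaux (Suc n) k \<mu>"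
  obtains (bottom) "2 \<le> k" "Z (1, k) = Suc n"
  | (corner) i where "i \<in> corners \<mu>" "Z (corner_box \<mu> i) = Suc n"
proof -
  note Y = young_tableauxD[OF assms(3)]
  have "Suc n \<in> Z ` diagram k \<mu>" using bij_betw_imp_surj_on[OF Y(2)] by simp
  then obtain r c where rc: "(r, c) \<in> diagram k \<mu>" "Z (r, c) = Suc n" by auto
  have max: "\<not> Suc n < Z p" if "p \<in> diagram k \<mu>" for p
    using bij_betwE[OF Y(2)] that by fastforce
  show thesis
  proof (cases "(r, c) \<in> bottom_row k")
    case True
    then have r: "r = 1" "1 \<le> c" "c \<le> k" by (auto simp: bottom_row_def)
    have "c = k"
    proof (rule ccontr)
      assume "c \<noteq> k"
      then have "c < k" using r by simp
      then have "Z (1, c) < Z (1, k)" using r by (intro Y(6)) (simp_all add: bottom_row_def)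
      moreover have "\<not> Suc n < Z (1, k)" using r by (intro max) (simp add: diagram_def bottom_row_def)
      ultimately show False using rc r by simp
    qed
    \<comment> \<open>Box \<open>(1, 1)\<close> holds 1, which differs from \<open>Suc n\<close> as
      \<open>n \<ge> 1\<close>.\<close>
    moreover have "c \<noteq> 1" using Y(3) rc r assms(2) by auto
    ultimately show thesis using bottom r rc by auto
  next
    case False
    then have top: "(r, c) \<in> top_diagram \<mu>" using rc by (auto simp: diagram_def)
    define i where "i = r - 2"
    have i: "r = i + 2" "i < length \<mu>" "1 \<le> c" "c \<le> \<mu> ! i"
      using top by (auto simp: top_diagram_def i_def)
    have c: "c = \<mu> ! i"
    proof (rule ccontr)
      assume "c \<noteq> \<mu> ! i"
      then have "c < \<mu> ! i" "(r, \<mu> ! i) \<in> top_diagram \<mu>"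
        using i by (simp_all add: top_diagram_def)
      then show False
        using Y(4)[OF top] max[of "(r, \<mu> ! i)"] rc(2) by (simp add: diagram_def)
    qed
    \<comment> \<open>A later row at least as long would contain a box above \<open>(r, c)\<close>
      with a larger entry.\<close>
    have "\<mu> ! j < \<mu> ! i" if "i < j" "j < length \<mu>" for j
    proof (rule ccontr)
      assume "\<not> \<mu> ! j < \<mu> ! i"
      then have "(j + 2, c) \<in> top_diagram \<mu>" "r < j + 2"
        using i c that by (simp_all add: top_diagram_def)
      then show False
        using Y(5)[OF top] max[of "(j + 2, c)"] rc(2) by (simp add: diagram_def)
    qed
    then have "i \<in> corners \<mu>" using i by (auto simp: corners_def)
    then show thesis using corner rc i c by simp
  qed
qed

lemma sum_g_index_Suc:
  assumes "is_type (Suc n) k \<mu>" "1 \<le> n"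
  shows "(\<Sum>Z\<in>young_tableaux (Suc n) k \<mu>. g_index (Suc n) k \<mu> Z) =
    (if 2 \<le> k then \<Sum>Z\<in>young_tableaux n (k - 1) (butlast \<mu>). g_index n (k - 1) (butlast \<mu>) Z else 0) +
    (\<Sum>i\<in>corners \<mu>. count_list (decr \<mu> i) (\<mu> ! i - 1) *
      (\<Sum>Z\<in>young_tableaux n k (butlast (decr \<mu> i)). g_index n k (butlast (decr \<mu> i)) Z))"
proof -
  let ?F = "\<lambda>b. {Z. Z \<in> young_tableaux (Suc n) k \<mu> \<and> Z b = Suc n}"
  let ?g = "g_index (Suc n) k \<mu>"
  \<comment> \<open>For \<open>k = 1\<close> the bottom row consists of the box holding 1
    alone.\<close>
  let ?B = "if 2 \<le> k then ?F (1, k) else {}"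
  have fin: "finite (?F b)" for b
    using finite_young_tableaux by (rule finite_subset[rotated]) auto
  \<comment> \<open>A tableau is injective, so \<open>Suc n\<close> occupies only one box.\<close>
  have disj: "?F a \<inter> ?F b = {}" if "a \<in> diagram k \<mu>" "b \<in> diagram k \<mu>" "a \<noteq> b" for a b
  proof -
    have False if "Z \<in> ?F a" "Z \<in> ?F b" for Z
      using that young_tableauxD(2)[of Z] \<open>a \<in> _\<close> \<open>b \<in> _\<close> \<open>a \<noteq> b\<close>
      by (auto simp: bij_betw_def inj_on_def)
    then show ?thesis by blast
  qed
  have corner_in: "corner_box \<mu> i \<in> diagram k \<mu>" if "i \<in> corners \<mu>" for i
    using removable_box.b_in[OF removable_corner[OF assms(1) that]] .
  have disj': "?B \<inter> ?F (corner_box \<mu> i) = {}" if "i \<in> corners \<mu>" for i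
    using disj[of "(1, k)" "corner_box \<mu> i"] corner_in[OF that]
    by (auto simp: diagram_def bottom_row_def)
  have "young_tableaux (Suc n) k \<mu> = ?B \<union> (\<Union>i\<in>corners \<mu>. ?F (corner_box \<mu> i))"
  proof (intro subset_antisym subsetI)
    fix Z assume Z: "Z \<in> young_tableaux (Suc n) k \<mu>"
    from assms Z show "Z \<in> ?B \<union> (\<Union>i\<in>corners \<mu>. ?F (corner_box \<mu> i))"
      by (cases rule: position_of_last) (use Z in auto)
  qed (auto split: if_splits)
  then have "sum ?g (young_tableaux (Suc n) k \<mu>) = sum ?g (?B \<union> (\<Union>i\<in>corners \<mu>. ?F (corner_box \<mu> i)))"
    by (rule arg_cong[where f = "sum ?g"])
  also have "\<dots> = sum ?g ?B + sum ?g (\<Union>i\<in>corners \<mu>. ?F (corner_box \<mu> i))"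
  proof (rule sum.union_disjoint)
    show "finite ?B" by (cases "2 \<le> k") (simp_all only: if_True if_False fin finite.emptyI)
    show "finite (\<Union>i\<in>corners \<mu>. ?F (corner_box \<mu> i))"
      by (rule finite_UN_I[OF finite_corners fin])
    show "?B \<inter> (\<Union>i\<in>corners \<mu>. ?F (corner_box \<mu> i)) = {}"
      unfolding Int_UN_distrib by (rule SUP_eqI, simp_all only: disj' bot_least)
  qed
  also have "sum ?g (\<Union>i\<in>corners \<mu>. ?F (corner_box \<mu> i)) = (\<Sum>i\<in>corners \<mu>. sum ?g (?F (corner_box \<mu> i)))"
  proof (rule sum.UNION_disjoint[OF finite_corners])
    show "\<forall>i\<in>corners \<mu>. finite (?F (corner_box \<mu> i))" by (rule ballI, rule fin)
    show "\<forall>i\<in>corners \<mu>. \<forall>j\<in>corners \<mu>. i \<noteq> j \<longrightarrow>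
        ?F (corner_box \<mu> i) \<inter> ?F (corner_box \<mu> j) = {}"
      by (intro ballI impI disj corner_in) simp_all
  qed
  also have "\<dots> = (\<Sum>i\<in>corners \<mu>. count_list (decr \<mu> i) (\<mu> ! i - 1) *
      (\<Sum>Z\<in>young_tableaux n k (butlast (decr \<mu> i)). g_index n k (butlast (decr \<mu> i)) Z))"
    by (intro sum.cong refl)
      (simp only: removable_box.sum_g_index[OF removable_corner[OF assms(1)]] box_weight_corner[OF assms(1)])
  also have "sum ?g ?B = (if 2 \<le> k then
      \<Sum>Z\<in>young_tableaux n (k - 1) (butlast \<mu>). g_index n (k - 1) (butlast \<mu>) Z else 0)"
  proof (cases "2 \<le> k")
    case True
    have "box_weight (Suc n) k \<mu> (1, k) = 1" by (simp add: box_weight_def)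
    then show ?thesis
      using True by (simp only: if_True removable_box.sum_g_index[OF removable_bottom[OF assms(1) True]] mult_1)
  qed simp
  finally show ?thesis .
qed

section \<open>Base case and induction\<close>

lemma p_num_1: "p_num 1 1 [] = 1"
proof -
  have "{e \<in> inversion_sequences 1. type_of_seq e = (1, [])} = {[0]}"
    by (auto simp: inversion_sequences_def type_of_seq_def length_Suc_conv)
  then show ?thesis by (simp add: p_num_def)
qed

lemma sum_g_index_1: "(\<Sum>Z\<in>young_tableaux 1 1 []. g_index 1 1 [] Z) = 1"
proof -
  let ?Z = "\<lambda>p\<in>{(1::nat, 1::nat)}. 1::nat"
  have D: "diagram 1 [] = {(1, 1)}" "bottom_row 1 = {(1, 1)}" "top_diagram [] = {}"
    by (auto simp: diagram_def bottom_row_def top_diagram_def)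
  have YT: "young_tableaux 1 1 [] = {?Z}"
    unfolding young_tableaux_def D by (auto simp: bij_betw_def extensional_def fun_eq_iff)
  have "the_inv_into {(1, 1)} ?Z 1 = (1, 1)" by (rule the_inv_into_f_eq) auto
  then have "g_value 1 1 [] ?Z 1 = 1"
    unfolding g_value_def D by (simp only: Let_def case_prod_conv if_True refl)
  then have "g_index 1 1 [] ?Z = 1" by (simp add: g_index_def)
  then show ?thesis unfolding YT by simp
qed

theorem theorem12:
  fixes n k :: nat and \<mu> :: "nat list"
  assumes "n \<ge> 1" and "is_type n k \<mu>"
  shows "p_num n k \<mu> = (\<Sum>Z\<in>young_tableaux n k \<mu>. g_index n k \<mu> Z)"
  using assms
proof (induction n arbitrary: k \<mu> rule: nat_induct_at_least)
  case base
  then have "k = 1" "\<mu> = []" by (auto simp: is_type_def)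
  then show ?case using p_num_1 sum_g_index_1 by simp
next
  case (Suc n)
  \<comment> \<open>The two recursions have the same coefficients, so the induction hypothesis
    identifies them term by term.\<close>
  show ?case
    unfolding p_num_Suc[OF Suc.prems Suc.hyps] sum_g_index_Suc[OF Suc.prems Suc.hyps]
    using Suc.IH is_type_bottom(1)[OF Suc.prems] is_type_decr(1)[OF Suc.prems]
    by (auto intro!: sum.cong)
qed

end
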